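(* Let $t\in(0,1)$ and $\chi\in\mathbb{R}_{>0}$. For any $L \in \mathbb{Z}$ and $x \in \mathbb{Z}_{\geq 0}$, $$\Pr(\mathcal{L}_{2,t,\chi} = (L+x,L)) =\frac{1}{(t;t)_\infty} \sum_{m \geq 0} e^{-\chi t^{L-m}} (-1)^m t^{m^2+(x-1)m+\binom{x}{2}} \sum_{i=0}^x \frac{(-1)^{x-i}}{(t;t)_{x-i}} \begin{bmatrix} m+i\\ i\end{bmatrix}_t \left(\frac{(t^{L-m}\chi)^{i+m}}{(i+m)!} + \frac{(t^{L-m}\chi)^{i+m-1}\,\mathbf{1}(i+m \geq 1)}{(i+m-1)!}\right).$$
   Context: Notation: $(a;t)_n = \prod_{i=1}^n(1-at^{i-1})$, $n \in \mathbb{Z}_{\ge0}\cup\{\infty\}$; $\begin{bmatrix} a \\ b\end{bmatrix}_t = \frac{(t;t)_a}{(t;t)_b(t;t)_{a-b}}$; $\mathbf{1}(\cdot)$ is an indicator (the second term in parentheses is $0$ when $i+m=0$). $\mathrm{Sig}_k$ is the set of weakly decreasing $k$-tuples of integers; for $\mu\in \mathrm{Sig}_{k-1}$, $\vec L\in\mathrm{Sig}_k$, $\mu\prec\vec L$ means $L_1\ge\mu_1\ge L_2\ge\cdots\ge\mu_{k-1}\ge L_k$. $|\cdot|$ is the sum of parts, and $\mu-(d[k-1])=(\mu_1-d,\ldots,\mu_{k-1}-d)$. $\lambda'$ is the conjugate partition, $m_i(\lambda)$ the number of parts of $\lambda$ equal to $i$. Hall-Littlewood functions: for a partition $\lambda$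 of length at most $n$, $P_\lambda(x_1,\ldots,x_n;0,t) = \frac{1}{v_\lambda(t)}\sum_{\sigma\in S_n}\sigma\left(x_1^{\lambda_1}\cdots x_n^{\lambda_n}\prod_{i<j}\frac{x_i-tx_j}{x_i-x_j}\right)$, where $v_\lambda(t)$ makes the coefficient of $x_1^{\lambda_1}\cdots x_n^{\lambda_n}$ equal to $1$. These are compatible under $x_n=0$ and define symmetric functions $P_\lambda\in\Lambda=\mathbb{C}[p_1,p_2,\ldots]$ ($p_k$ the power sums); $Q_\lambda = \prod_{i\ge1}(t;t)_{m_i(\lambda)}\,P_\lambda$. $Q_\lambda(\gamma(\tau),\alpha(1);0,t)$ is the image of $Q_\lambda$ under the homomorphism $\Lambda\to\mathbb{C}$ with $p_1\mapsto 1+\frac{\tau}{1-t}$ and $p_k\mapsto 1$ for $k\ge2$. For $k\ge1$, $\mathcal{L}_{k,t,\chi}$ is the $\mathrm{Sig}_k$-valued random variable with law $$\Pr(\mathcal{L}_{k,t,\chi} = (L_1,\ldots,L_k)) = \frac{1}{(t;t)_\infty}\sum_{d \leq L_k} e^{-\chi t^d} \frac{t^{\sum_{i=1}^k \binom{L_i-d}{2}}}{ (t;t)_{L_k-d} \prod_{i=1}^{k-1}(t;t)_{L_i-L_{i+1}}} \sum_{\substack{\mu \in \mathrm{Sig}_{k-1} \\ \mu \prec \vec{L}}} (-1)^{|\vec{L}| - |\mu|-d} \prod_{i=1}^{k-1} \begin{bmatrix}L_i-L_{i+1}\\ L_i-\mu_i\end{bmatrix}_t Q_{(\mu - (d[k-1]))'}(\gamma((1-t)t^d\chi),\alpha(1);0,t),$$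 where $\vec L=(L_1,\ldots,L_k)$ and $d$ ranges over integers (this is known to be a probability distribution on $\mathrm{Sig}_k$). *)

theory Defs
  imports "HOL-Probability.Probability" "HOL-Library.Poly_Mapping"
begin

section \<open>q-Pochhammer symbols and q-binomial coefficients\<close>

definition qpoch :: "'a::comm_ring_1 \<Rightarrow> 'a \<Rightarrow> nat \<Rightarrow> 'a" where
  "qpoch a t n = (\<Prod>i=1..n. 1 - a * t ^ (i - 1))"

definition qpoch_inf :: "real \<Rightarrow> real \<Rightarrow> real" where
  "qpoch_inf a t = prodinf (\<lambda>i. 1 - a * t ^ i)"

text \<open>Only meaningful for \<open>b \<le> a\<close>, because of the truncated subtraction.\<close>

definition qbinom :: "real \<Rightarrow> nat \<Rightarrow> nat \<Rightarrow> real" where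
  "qbinom t a b = qpoch t t a / (qpoch t t b * qpoch t t (a - b))"


section \<open>Partitions and signatures\<close>

text \<open>A partition is the weakly decreasing list of its nonzero parts, so that its length is the
  length of the list. The conjugate is defined for any list of natural numbers; it ignores zero
  entries and always returns a partition in this sense.\<close>

definition conjugate :: "nat list \<Rightarrow> nat list" where
  "conjugate l = map (\<lambda>j. length (filter (\<lambda>a. j \<le> a) l)) [1..<Suc (Max (insert 0 (set l)))]"

definition Sig :: "nat \<Rightarrow> int list set" where
  "Sig k = {L. length L = k \<and> sorted_wrt (\<ge>) L}"

text \<open>List positions start at 0: the entry \<open>L\<^sub>i\<close> of a signature is \<open>L ! (i - 1)\<close>.\<close>

definition interlacing :: "int list \<Rightarrow> int list \<Rightarrow> bool" where
  "interlacing \<mu> L \<longleftrightarrow> (\<forall>i<length L - 1. L ! i \<ge> \<mu> ! i \<and> \<mu> ! i \<ge> L ! Suc i)"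


section \<open>Hall-Littlewood functions\<close>

text \<open>Polynomials in the variables indexed by \<^typ>\<open>nat\<close>, as finitely supported functions from
  monomials to coefficients. \<open>poly_eval f x\<close> is the image of \<open>f\<close> under the algebra homomorphism
  that sends the \<open>i\<close>-th variable to \<open>x i\<close>.\<close>

type_synonym cpoly = "(nat \<Rightarrow>\<^sub>0 nat) \<Rightarrow>\<^sub>0 complex"

definition poly_eval :: "cpoly \<Rightarrow> (nat \<Rightarrow> complex) \<Rightarrow> complex" where
  "poly_eval f x =
     (\<Sum>m\<in>Poly_Mapping.keys f. Poly_Mapping.lookup f m *
        (\<Prod>i\<in>Poly_Mapping.keys m. x i ^ Poly_Mapping.lookup m i))"

text \<open>The symmetrisation in \<open>n\<close> variables \<open>x 0, \<dots>, x (n - 1)\<close>, at a point with pairwise distinct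
  coordinates. It requires \<open>length l \<le> n\<close>; the missing parts are zero and contribute no factor.\<close>

definition hl_sum :: "nat \<Rightarrow> nat list \<Rightarrow> complex \<Rightarrow> (nat \<Rightarrow> complex) \<Rightarrow> complex" where
  "hl_sum n l t x =
     (\<Sum>\<sigma>\<in>{\<sigma>. \<sigma> permutes {..<n}}.
        (\<Prod>i<length l. x (\<sigma> i) ^ (l ! i)) *
        (\<Prod>j<n. \<Prod>i<j. (x (\<sigma> i) - t * x (\<sigma> j)) / (x (\<sigma> i) - x (\<sigma> j))))"

text \<open>The polynomial \<open>P\<^sub>l(x\<^sub>0, \<dots>, x\<^bsub>n-1\<^esub>; 0, t)\<close>. A polynomial over the complex numbers is
  determined by its values at the points with distinct coordinates, so the evaluation condition is
  the identity of rational functions. \<open>Poly_Mapping.nth l\<close> is the exponent vector of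
  \<open>x\<^sub>0^(l ! 0) * x\<^sub>1^(l ! 1) * \<dots>\<close>, and the normalisation \<open>v\<close> is fixed by the coefficient 1 there.\<close>

definition hl_poly :: "nat \<Rightarrow> nat list \<Rightarrow> complex \<Rightarrow> cpoly" where
  "hl_poly n l t =
     (THE f. (\<forall>m\<in>Poly_Mapping.keys f. Poly_Mapping.keys m \<subseteq> {..<n}) \<and>
             Poly_Mapping.lookup f (Poly_Mapping.nth l) = 1 \<and>
             (\<exists>v. v \<noteq> 0 \<and> (\<forall>x. inj_on x {..<n} \<longrightarrow> poly_eval f x = 1 / v * hl_sum n l t x)))"

text \<open>The ring of symmetric functions is the polynomial ring in the power sums; here variable
  number \<open>k\<close> of \<^typ>\<open>cpoly\<close> stands for the power sum \<open>p\<^bsub>k+1\<^esub>\<close>. The symmetric function \<open>P\<^sub>l\<close> is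
  the one that restricts to \<open>hl_poly n l t\<close> in \<open>n\<close> variables, for all \<open>n \<ge> length l\<close>.\<close>

definition hl_P :: "nat list \<Rightarrow> complex \<Rightarrow> cpoly" where
  "hl_P l t =
     (THE f. \<forall>n\<ge>length l. \<forall>x.
        poly_eval f (\<lambda>k. \<Sum>i<n. x i ^ (k + 1)) = poly_eval (hl_poly n l t) x)"

definition hl_Q :: "nat list \<Rightarrow> complex \<Rightarrow> cpoly" where
  "hl_Q l t =
     Poly_Mapping.map (\<lambda>c. (\<Prod>i\<in>set l. qpoch t t (count_list l i)) * c) (hl_P l t)"

text \<open>\<open>Q\<^sub>l(\<gamma>(\<tau>), \<alpha>(1); 0, t)\<close>: the specialisation \<open>p\<^sub>1 \<mapsto> 1 + \<tau> / (1 - t)\<close> and \<open>p\<^sub>k \<mapsto> 1\<close> for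
  \<open>k \<ge> 2\<close>.\<close>

definition Q_spec :: "nat list \<Rightarrow> complex \<Rightarrow> complex \<Rightarrow> complex" where
  "Q_spec l \<tau> t = poly_eval (hl_Q l t) (\<lambda>k. if k = 0 then 1 + \<tau> / (1 - t) else 1)"


section \<open>The limiting law\<close>

text \<open>The differences converted with \<^const>\<open>nat\<close> are nonnegative, since \<open>L\<close> is weakly
  decreasing, \<open>d\<close> is at most its last entry and \<open>\<mu>\<close> interlaces \<open>L\<close>. The value is complex only
  because \<open>Q_spec\<close> is. For \<open>0 < t < 1\<close> and \<open>chi > 0\<close> the sum over \<open>d\<close> converges absolutely.\<close>

definition law_mass :: "nat \<Rightarrow> real \<Rightarrow> real \<Rightarrow> int list \<Rightarrow> complex" where
  "law_mass k t chi L =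
     1 / complex_of_real (qpoch_inf t t) *
     (\<Sum>\<^sub>\<infinity>d\<in>{..L ! (k - 1)}.
        complex_of_real
          (exp (- chi * t powi d) *
           (t ^ (\<Sum>i<k. nat (L ! i - d) choose 2) /
            (qpoch t t (nat (L ! (k - 1) - d)) *
             (\<Prod>i<k - 1. qpoch t t (nat (L ! i - L ! Suc i)))))) *
        (\<Sum>\<mu>\<in>{\<mu>\<in>Sig (k - 1). interlacing \<mu> L}.
           (-1) powi (sum_list L - sum_list \<mu> - d) *
           complex_of_real
             (\<Prod>i<k - 1. qbinom t (nat (L ! i - L ! Suc i)) (nat (L ! i - \<mu> ! i))) *
           Q_spec (conjugate (map (\<lambda>a. nat (a - d)) \<mu>))
             (complex_of_real ((1 - t) * t powi d * chi)) (complex_of_real t)))"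

text \<open>\<open>X\<close> is a \<open>Sig k\<close>-valued random variable on the probability space \<open>M\<close>, distributed as
  \<open>\<L>\<^bsub>k,t,chi\<^esub>\<close>.\<close>

definition has_law_L :: "nat \<Rightarrow> real \<Rightarrow> real \<Rightarrow> 'w measure \<Rightarrow> ('w \<Rightarrow> int list) \<Rightarrow> bool" where
  "has_law_L k t chi M X \<longleftrightarrow>
     prob_space M \<and> X \<in> measurable M (count_space (Sig k)) \<and>
     (\<forall>L\<in>Sig k. complex_of_real (measure M {\<omega>\<in>space M. X \<omega> = L}) = law_mass k t chi L)"

end

theory Submission
  imports Defs
begin

text \<open>For \<open>k = 2\<close> the signature \<open>\<mu>\<close> has a single part, so only the functions \<open>Q\<close> of one-column
  partitions occur. Summing over the last variable first, the symmetrisation that defines \<open>P\<close> of a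
  column reduces to an interpolation identity and equals a constant times the elementary symmetric
  polynomial \<open>e\<^sub>n\<close>. Newton's identities express \<open>e\<^sub>n\<close> in the power sums; under the specialisation
  the generating function of the \<open>e\<^sub>n\<close> becomes \<open>(1 + z) exp (y z)\<close> with \<open>y = t\<^sup>d \<chi>\<close>, whose
  coefficients are the bracketed terms of the formula. Substituting \<open>d = L - m\<close> and
  \<open>\<mu>\<^sub>1 = L + i\<close> then gives the result.\<close>

section \<open>The Hall-Littlewood symmetrisation of a column\<close>

text \<open>The index set is arbitrary rather than \<open>{..<n}\<close>, so that a single variable
  can be deleted.\<close>

definition esym :: "nat \<Rightarrow> 'b set \<Rightarrow> ('b \<Rightarrow> 'a::comm_semiring_1) \<Rightarrow> 'a" where
  "esym n A x = (\<Sum>S | S \<subseteq> A \<and> card S = n. \<Prod>i\<in>S. x i)"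

lemma esym_reindex:
  assumes "bij_betw h A B"
  shows "esym n A (x \<circ> h) = esym n B x"
proof -
  have inj: "inj_on h S" if "S \<subseteq> A" for S
    using assms that by (meson bij_betw_def inj_on_subset)
  have "bij_betw ((`) h) {S. S \<subseteq> A \<and> card S = n} {S. S \<subseteq> B \<and> card S = n}"
  proof (rule bij_betw_byWitness[where f' = "(`) (inv_into A h)"])
    show "\<forall>S\<in>{S. S \<subseteq> A \<and> card S = n}. inv_into A h ` h ` S = S"
      using assms by (metis (no_types, lifting) bij_betw_def inv_into_image_cancel mem_Collect_eq)
    show "\<forall>S\<in>{S. S \<subseteq> B \<and> card S = n}. h ` inv_into A h ` S = S"
      using assms by (metis (no_types, lifting) bij_betw_def image_inv_into_cancel mem_Collect_eq)
    show "(`) h ` {S. S \<subseteq> A \<and> card S = n} \<subseteq> {S. S \<subseteq> B \<and> card S = n}"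
      using assms inj by (auto simp: card_image bij_betw_def)
    show "(`) (inv_into A h) ` {S. S \<subseteq> B \<and> card S = n} \<subseteq> {S. S \<subseteq> A \<and> card S = n}"
    proof safe
      fix S assume S: "S \<subseteq> B" "n = card S"
      have "inj_on (inv_into A h) S"
        using S assms by (metis bij_betw_def inj_on_inv_into)
      then show "card (inv_into A h ` S) = card S" by (rule card_image)
      fix y assume "y \<in> S"
      then show "inv_into A h y \<in> A"
        using S assms by (metis bij_betw_def inv_into_into subsetD)
    qed
  qed
  then have "esym n B x = (\<Sum>S | S \<subseteq> A \<and> card S = n. \<Prod>i\<in>h ` S. x i)"
    unfolding esym_def by (rule sum.reindex_bij_betw[symmetric])
  also have "\<dots> = esym n A (x \<circ> h)"
    unfolding esym_def by (intro sum.cong refl) (simp add: prod.reindex inj)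
  finally show ?thesis ..
qed

text \<open>Vieta's formula: expanding the product selects the constant in the factors of a subset
  \<open>S\<close> and the variable in the others, which gives degree
  \<open>card A - card S\<close>. The bound on \<open>k\<close> keeps the truncated difference
  exact.\<close>

lemma coeff_prod_linear:
  fixes x :: "'b \<Rightarrow> 'a::comm_semiring_1"
  assumes "finite A" and "k \<le> card A"
  shows "coeff (\<Prod>i\<in>A. [:x i, 1:]) (card A - k) = esym k A x"
proof -
  have "(\<Prod>i\<in>A. [:x i, 1:]) = (\<Prod>i\<in>A. [:x i:] + [:0, 1:])" by simp
  also have "\<dots> = (\<Sum>S\<in>Pow A. (\<Prod>i\<in>S. [:x i:]) * (\<Prod>i\<in>A - S. [:0, 1:]))"
    by (rule prod_add) fact
  also have "\<dots> = (\<Sum>S\<in>Pow A. monom (\<Prod>i\<in>S. x i) (card (A - S)))"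
  proof (rule sum.cong[OF refl])
    fix S
    have "(\<Prod>i\<in>S. [:x i:]) = [:\<Prod>i\<in>S. x i:]"
      by (induction S rule: infinite_finite_induct) (auto simp: one_pCons mult_ac)
    then show "(\<Prod>i\<in>S. [:x i:]) * (\<Prod>i\<in>A - S. [:0, 1:]) = monom (\<Prod>i\<in>S. x i) (card (A - S))"
      by (simp add: monom_altdef)
  qed
  finally have "coeff (\<Prod>i\<in>A. [:x i, 1:]) (card A - k) =
      (\<Sum>S\<in>Pow A. if card (A - S) = card A - k then \<Prod>i\<in>S. x i else 0)"
    by (simp add: coeff_sum if_distrib cong: if_cong)
  also have "\<dots> = (\<Sum>S\<in>Pow A. if card S = k then \<Prod>i\<in>S. x i else 0)"
  proof (rule sum.cong[OF refl])
    fix S assume S: "S \<in> Pow A"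
    then have "card (A - S) = card A - card S" "card S \<le> card A"
      using assms by (auto simp: card_Diff_subset finite_subset card_mono)
    then have "card (A - S) = card A - k \<longleftrightarrow> card S = k"
      using assms by auto
    then show "(if card (A - S) = card A - k then \<Prod>i\<in>S. x i else 0) =
        (if card S = k then \<Prod>i\<in>S. x i else 0)" by simp
  qed
  also have "\<dots> = esym k A x"
    using assms unfolding esym_def by (subst sum.inter_filter[symmetric]) auto
  finally show ?thesis .
qed

lemma degree_prod_linear_le: "degree (\<Prod>i\<in>A. [:x i, 1:]) \<le> card A"
proof (cases "finite A")
  case True
  then show ?thesis
    using degree_prod_sum_le[OF True, of "\<lambda>i. [:x i, 1:]"] by simp
qed simp

text \<open>The difference vanishes at 0, so the variable divides it, and the constant
  \<open>t - 1\<close> is a unit.\<close>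

lemma q_difference_quotient:
  fixes p :: "'a::field poly"
  assumes "t \<noteq> 1"
  obtains r where "[:0, t - 1:] * r = pcompose p [:0, t:] - p"
proof -
  have "poly (pcompose p [:0, t:] - p) 0 = 0" by (simp add: poly_pcompose)
  then obtain s where "pcompose p [:0, t:] - p = [:0, 1:] * s"
    using poly_eq_0_iff_dvd[of "pcompose p [:0, t:] - p" 0] by (auto elim: dvdE)
  then have "[:0, t - 1:] * smult (1 / (t - 1)) s = pcompose p [:0, t:] - p"
    using assms by simp
  then show ?thesis by (rule that)
qed

text \<open>Both sides are coefficients of \<open>(p(t z) - p(z)) / ((t - 1) z)\<close> for
  \<open>p(z) = \<Prod>\<^sub>i (z + x\<^sub>i)\<close>. This polynomial has degree less than \<open>card A\<close>, and Lagrange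
  interpolation at the points \<open>- x\<^sub>a\<close> gives the left-hand side.\<close>

lemma esym_delete_sum:
  fixes x :: "'b \<Rightarrow> 'a::field"
  assumes fin: "finite A" and inj: "inj_on x A" and n: "n < card A" and t: "t \<noteq> 1"
  shows "(\<Sum>a\<in>A. (\<Prod>b\<in>A - {a}. (x b - t * x a) / (x b - x a)) * esym n (A - {a}) x) =
    (\<Sum>i<card A - n. t ^ i) * esym n A x"
proof -
  define B where "B a = (\<Prod>b\<in>A - {a}. (x b - t * x a) / (x b - x a))" for a
  define p where "p = (\<Prod>i\<in>A. [:x i, 1:])"
  define q where "q = (\<Sum>a\<in>A. smult (B a) (\<Prod>i\<in>A - {a}. [:x i, 1:]))"
  obtain r where r: "[:0, t - 1:] * r = pcompose p [:0, t:] - p"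
    using q_difference_quotient[OF t] .
  have "r = q"
  proof (rule poly_eqI_degree)
    have card: "card ((\<lambda>a. - x a) ` A) = card A"
      using inj by (intro card_image) (auto simp: inj_on_def)
    have "degree r < card A"
    proof (cases "r = 0")
      case False
      have "degree ([:0, t - 1:] * r) = Suc (degree r)"
        using False t by (subst degree_mult_eq) auto
      moreover have "degree (pcompose p [:0, t:] - p) \<le> card A"
        unfolding p_def
        by (intro degree_diff_le order.trans[OF degree_pcompose_le] degree_prod_linear_le)
           (use degree_prod_linear_le[of x A] in auto)
      ultimately show ?thesis unfolding r by linarith
    qed (use n in auto)
    then show "degree r < card ((\<lambda>a. - x a) ` A)" using card by simp
    have "degree q \<le> card A - 1"
      unfolding q_def
    proof (intro degree_sum_le fin)
      fix a assume "a \<in> A"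
      then show "degree (smult (B a) (\<Prod>i\<in>A - {a}. [:x i, 1:])) \<le> card A - 1"
        using degree_prod_linear_le[of x "A - {a}"] degree_smult_le order.trans fin by fastforce
    qed
    then show "degree q < card ((\<lambda>a. - x a) ` A)" using card n by simp
  next
    fix z assume "z \<in> (\<lambda>a. - x a) ` A"
    then obtain a where a: "a \<in> A" and z: "z = - x a" by auto
    define g where "g = (\<Prod>i\<in>A - {a}. [:x i, 1:])"
    have pg: "p = [:x a, 1:] * g"
      unfolding p_def g_def using a fin by (simp add: prod.remove)
    \<comment> \<open>A product rule for the q-difference isolates a term with the factor
      \<open>[:x a, 1:]\<close>. It vanishes at \<open>- x a\<close>, so only the value of
      \<open>g\<close> at \<open>- t * x a\<close> survives.\<close>
    obtain s where s: "[:0, t - 1:] * s = pcompose g [:0, t:] - g"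
      using q_difference_quotient[OF t] .
    have "[:0, t - 1:] * r = [:x a, t:] * pcompose g [:0, t:] - [:x a, 1:] * g"
      unfolding r pg pcompose_mult by (simp add: pcompose_pCons del: mult_pCons_left)
    also have "\<dots> = [:0, t - 1:] * pcompose g [:0, t:] + [:x a, 1:] * (pcompose g [:0, t:] - g)"
    proof -
      have "[:x a, t:] = [:0, t - 1:] + [:x a, 1:]" by simp
      then show ?thesis by (simp only: algebra_simps)
    qed
    also have "\<dots> = [:0, t - 1:] * (pcompose g [:0, t:] + [:x a, 1:] * s)"
      unfolding s[symmetric] by (simp only: algebra_simps)
    finally have "r = pcompose g [:0, t:] + [:x a, 1:] * s"
      using t by (subst (asm) mult_cancel_left) auto
    then have "poly r z = (\<Prod>b\<in>A - {a}. x b - t * x a)"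
      unfolding g_def z by (simp add: poly_pcompose poly_prod mult.commute)
    also have "\<dots> = B a * (\<Prod>b\<in>A - {a}. x b - x a)"
      unfolding B_def using a inj
      by (subst prod.distrib[symmetric], intro prod.cong) (auto simp: inj_on_def)
    \<comment> \<open>In the summand of \<open>q\<close> for any other \<open>c\<close> the product
      contains the factor at \<open>a\<close>, which is zero at \<open>- x a\<close>.\<close>
    also have "\<dots> = (\<Sum>c\<in>A. if c = a then B a * (\<Prod>b\<in>A - {a}. x b - x a) else 0)"
      using a fin by simp
    also have "\<dots> = poly q z"
      unfolding q_def poly_sum using a fin
      by (intro sum.cong) (auto simp: poly_prod z intro!: prod_zero)
    finally show "poly r z = poly q z" .
  qed
  \<comment> \<open>Dividing by the variable lowers degrees by one, so coefficient \<open>j\<close>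
    of \<open>r\<close> comes from coefficient \<open>card A - n\<close> of \<open>p\<close>, which
    is \<open>esym n A x\<close>. In \<open>q\<close> the deleted factor accounts for the same
    shift.\<close>
  define j where "j = card A - 1 - n"
  have j: "Suc j = card A - n" using n by (simp add: j_def)
  have "(t - 1) * coeff r j = coeff ([:0, t - 1:] * r) (Suc j)" by simp
  also have "\<dots> = (t ^ Suc j - 1) * coeff p (card A - n)"
    unfolding r by (simp add: coeff_pcompose_linear j algebra_simps flip: power_Suc)
  also have "\<dots> = (t - 1) * ((\<Sum>i<card A - n. t ^ i) * esym n A x)"
    unfolding p_def using n fin by (simp add: coeff_prod_linear power_diff_1_eq j)
  finally have "coeff r j = (\<Sum>i<card A - n. t ^ i) * esym n A x"
    using t by simp
  moreover have "coeff q j = (\<Sum>a\<in>A. B a * esym n (A - {a}) x)"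
    unfolding q_def coeff_sum
  proof (intro sum.cong refl)
    fix a assume a: "a \<in> A"
    then have "coeff (\<Prod>i\<in>A - {a}. [:x i, 1:]) (card (A - {a}) - n) = esym n (A - {a}) x"
      using fin n by (intro coeff_prod_linear) auto
    then show "coeff (smult (B a) (\<Prod>i\<in>A - {a}. [:x i, 1:])) j = B a * esym n (A - {a}) x"
      using a fin by (simp add: j_def)
  qed
  ultimately show ?thesis
    using \<open>r = q\<close> unfolding B_def by simp
qed

text \<open>Permutations are sorted by the image \<open>b\<close> of the last index: each is a
  permutation of \<open>{..<n}\<close> followed by the transposition of \<open>n\<close> and
  \<open>b\<close>. The factors with \<open>j = n\<close> form a product over all indices other than
  \<open>b\<close>, so they leave the inner sum.\<close>

lemma hl_sum_Suc:
  assumes "length l \<le> n"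
  shows "hl_sum (Suc n) l t x =
    (\<Sum>b\<in>{..<Suc n}. (\<Prod>c\<in>{..<Suc n} - {b}. (x c - t * x b) / (x c - x b)) *
       hl_sum n l t (x \<circ> Transposition.transpose n b))"
proof -
  define G where "G y \<sigma> = (\<Prod>i<length l. y (\<sigma> i) ^ (l ! i)) *
      (\<Prod>j<n. \<Prod>i<j. (y (\<sigma> i) - t * y (\<sigma> j)) / (y (\<sigma> i) - y (\<sigma> j)))"
    for y :: "nat \<Rightarrow> complex" and \<sigma> :: "nat \<Rightarrow> nat"
  define H where "H \<sigma> = (\<Prod>i<n. (x (\<sigma> i) - t * x (\<sigma> n)) / (x (\<sigma> i) - x (\<sigma> n)))"
    for \<sigma> :: "nat \<Rightarrow> nat"
  have "hl_sum (Suc n) l t x = (\<Sum>\<sigma>\<in>{\<sigma>. \<sigma> permutes {..<Suc n}}. G x \<sigma> * H \<sigma>)"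
    unfolding hl_sum_def G_def H_def by (simp add: mult.assoc)
  also have "\<dots> = (\<Sum>b\<in>{..<Suc n}. \<Sum>\<sigma>\<in>{\<sigma>. \<sigma> permutes {..<n}}.
      G x (Transposition.transpose n b \<circ> \<sigma>) * H (Transposition.transpose n b \<circ> \<sigma>))"
    using sum_over_permutations_insert[of "{..<n}" n "\<lambda>\<sigma>. G x \<sigma> * H \<sigma>"]
    by (simp add: lessThan_Suc)
  also have "\<dots> = (\<Sum>b\<in>{..<Suc n}. (\<Prod>c\<in>{..<Suc n} - {b}. (x c - t * x b) / (x c - x b)) *
       hl_sum n l t (x \<circ> Transposition.transpose n b))"
  proof (rule sum.cong[OF refl])
    fix b assume b: "b \<in> {..<Suc n}"
    have "H (Transposition.transpose n b \<circ> \<sigma>) = (\<Prod>c\<in>{..<Suc n} - {b}. (x c - t * x b) / (x c - x b))"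
      if \<sigma>: "\<sigma> permutes {..<n}" for \<sigma>
    proof -
      have "\<sigma> n = n" using \<sigma> by (simp add: permutes_not_in)
      have "Transposition.transpose n b permutes {..<Suc n}" using b by (intro permutes_swap_id) auto
      then have "bij_betw (Transposition.transpose n b) ({..<Suc n} - {n}) ({..<Suc n} - {Transposition.transpose n b n})"
        using b by (intro bij_betw_DiffI) (auto simp: permutes_imp_bij)
      moreover have "{..<Suc n} - {n} = {..<n}" by auto
      ultimately have "bij_betw (Transposition.transpose n b) {..<n} ({..<Suc n} - {b})" by simp
      then have "bij_betw (Transposition.transpose n b \<circ> \<sigma>) {..<n} ({..<Suc n} - {b})"
        using \<sigma> by (meson bij_betw_trans permutes_imp_bij)
      from prod.reindex_bij_betw[OF this, of "\<lambda>c. (x c - t * x b) / (x c - x b)"]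
      show ?thesis unfolding H_def by (simp add: \<open>\<sigma> n = n\<close>)
    qed
    moreover have "G x (Transposition.transpose n b \<circ> \<sigma>) = G (x \<circ> Transposition.transpose n b) \<sigma>" for \<sigma>
      by (simp add: G_def)
    moreover have "hl_sum n l t y = (\<Sum>\<sigma>\<in>{\<sigma>. \<sigma> permutes {..<n}}. G y \<sigma>)" for y
      unfolding hl_sum_def G_def ..
    ultimately show "(\<Sum>\<sigma>\<in>{\<sigma>. \<sigma> permutes {..<n}}.
        G x (Transposition.transpose n b \<circ> \<sigma>) * H (Transposition.transpose n b \<circ> \<sigma>)) =
      (\<Prod>c\<in>{..<Suc n} - {b}. (x c - t * x b) / (x c - x b)) * hl_sum n l t (x \<circ> Transposition.transpose n b)"
      by (simp add: mult.commute flip: sum_distrib_right)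
  qed
  finally show ?thesis .
qed

text \<open>The t-factorial [n]_t!, written without division by powers of 1 - t.\<close>

definition qfact :: "'a::comm_semiring_1 \<Rightarrow> nat \<Rightarrow> 'a" where
  "qfact t n = (\<Prod>k=1..n. \<Sum>i<k. t ^ i)"

text \<open>The inductive step in the number of variables, kept separate because the induction
  invokes it both for the column and for the empty partition. \<open>hl_sum_Suc\<close> followed by
  \<open>esym_delete_sum\<close> contributes the factor [N - n]_t that extends the
  t-factorial.\<close>

lemma hl_sum_ones_less:
  assumes "inj_on x {..<N}" and "t \<noteq> 1" and "n < N"
    and "\<And>y. inj_on y {..<N - 1} \<Longrightarrow>
      hl_sum (N - 1) (replicate n 1) t y = qfact t n * qfact t (N - 1 - n) * esym n {..<N - 1} y"
  shows "hl_sum N (replicate n 1) t x = qfact t n * qfact t (N - n) * esym n {..<N} x"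
proof -
  obtain M where M: "N = Suc M" using assms(3) by (cases N) auto
  define B where "B b = (\<Prod>c\<in>{..<N} - {b}. (x c - t * x b) / (x c - x b))" for b
  have "hl_sum N (replicate n 1) t x =
    (\<Sum>b\<in>{..<N}. B b * hl_sum M (replicate n 1) t (x \<circ> Transposition.transpose M b))"
    unfolding M B_def using assms(3) M by (intro hl_sum_Suc) auto
  also have "\<dots> = (\<Sum>b\<in>{..<N}. B b * (qfact t n * qfact t (M - n) * esym n ({..<N} - {b}) x))"
  proof (intro sum.cong refl arg_cong2[where f = "(*)"])
    fix b assume b: "b \<in> {..<N}"
    have "Transposition.transpose M b permutes {..<N}" using b M by (intro permutes_swap_id) auto
    then have "bij_betw (Transposition.transpose M b) ({..<N} - {M}) ({..<N} - {Transposition.transpose M b M})"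
      using b M by (intro bij_betw_DiffI) (auto simp: permutes_imp_bij)
    moreover have "{..<N} - {M} = {..<M}" using M by auto
    ultimately have bij: "bij_betw (Transposition.transpose M b) {..<M} ({..<N} - {b})" by simp
    then have "inj_on (x \<circ> Transposition.transpose M b) {..<M}"
      using assms(1) by (metis Diff_subset bij_betw_def comp_inj_on inj_on_subset)
    then show "hl_sum M (replicate n 1) t (x \<circ> Transposition.transpose M b) =
        qfact t n * qfact t (M - n) * esym n ({..<N} - {b}) x"
      using assms(4)[of "x \<circ> Transposition.transpose M b"] esym_reindex[OF bij, of n x] M by simp
  qed
  also have "\<dots> = qfact t n * qfact t (M - n) * (\<Sum>b\<in>{..<N}. B b * esym n ({..<N} - {b}) x)"
    by (simp add: sum_distrib_left mult_ac)
  also have "(\<Sum>b\<in>{..<N}. B b * esym n ({..<N} - {b}) x) = (\<Sum>i<N - n. t ^ i) * esym n {..<N} x"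
    unfolding B_def using esym_delete_sum[of "{..<N}" x n t] assms by simp
  also have "qfact t n * qfact t (M - n) * \<dots> = qfact t n * qfact t (N - n) * esym n {..<N} x"
    using assms(3) M by (simp add: qfact_def Suc_diff_le)
  finally show ?thesis .
qed

lemma hl_sum_ones:
  assumes "inj_on x {..<N}" and "t \<noteq> 1" and "n \<le> N"
  shows "hl_sum N (replicate n 1) t x = qfact t n * qfact t (N - n) * esym n {..<N} x"
  using assms
proof (induction N arbitrary: n x)
  case 0
  have "{S::nat set. S = {} \<and> card S = 0} = {{}}" by auto
  then show ?case using 0 by (simp add: hl_sum_def qfact_def esym_def)
next
  case (Suc M)
  show ?case
  proof (cases "n = Suc M")
    case False
    then have "n \<le> M" using Suc.prems(3) by simp
    show ?thesis
      by (rule hl_sum_ones_less) (use Suc.prems \<open>n \<le> M\<close> Suc.IH[of _ n] in simp_all)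
  next
    case True
    have "{S::nat set. S \<subseteq> {..<n} \<and> card S = n} = {{..<n}}"
      using card_subset_eq[of "{..<n}"] by auto
    then have esym_n: "esym n {..<n} x = (\<Prod>i<n. x i)"
      by (simp add: esym_def)
    have "{S::nat set. S \<subseteq> {..<n} \<and> card S = 0} = {{}}"
      by (auto dest: finite_subset)
    then have esym_0: "esym 0 {..<n} x = 1" by (simp add: esym_def)
    \<comment> \<open>With as many parts as variables the monomial is the symmetric product of all
      variables. Factoring it out leaves the empty partition, to which the strict case
      \<open>0 < n\<close> applies.\<close>
    have "hl_sum n (replicate n 1) t x = (\<Prod>i<n. x i) * hl_sum n (replicate 0 1) t x"
      unfolding hl_sum_def sum_distrib_left
    proof (intro sum.cong refl)
      fix \<sigma> assume "\<sigma> \<in> {\<sigma>. \<sigma> permutes {..<n}}"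
      then have "(\<Prod>i<n. x (\<sigma> i)) = (\<Prod>i<n. x i)"
        by (intro prod.reindex_bij_betw) (auto simp: permutes_imp_bij)
      then show "(\<Prod>i<length (replicate n 1). x (\<sigma> i) ^ (replicate n 1 ! i)) *
         (\<Prod>j<n. \<Prod>i<j. (x (\<sigma> i) - t * x (\<sigma> j)) / (x (\<sigma> i) - x (\<sigma> j))) =
         (\<Prod>i<n. x i) * ((\<Prod>i<length (replicate 0 1). x (\<sigma> i) ^ (replicate 0 1 ! i)) *
         (\<Prod>j<n. \<Prod>i<j. (x (\<sigma> i) - t * x (\<sigma> j)) / (x (\<sigma> i) - x (\<sigma> j))))"
        by simp
    qed
    also have "hl_sum n (replicate 0 1) t x = qfact t 0 * qfact t (n - 0) * esym 0 {..<n} x"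
      unfolding True by (rule hl_sum_ones_less) (use Suc.prems Suc.IH[of _ 0] in simp_all)
    finally show ?thesis using esym_n esym_0 True by (simp add: qfact_def)
  qed
qed

text \<open>A vanishing factor would make \<open>t\<close> a root of unity, contrary to
  \<open>norm t < 1\<close>.\<close>

lemma qfact_nonzero:
  fixes t :: "'a::real_normed_field"
  assumes "norm t < 1"
  shows "qfact t n \<noteq> 0"
proof -
  have "(\<Sum>i<k. t ^ i) \<noteq> 0" if "k \<ge> 1" for k
  proof
    assume "(\<Sum>i<k. t ^ i) = 0"
    then have "t ^ k = 1" using one_diff_power_eq[of t k] by simp
    then have "norm t ^ k = 1" by (metis norm_one norm_power)
    moreover have "norm t ^ k < 1" using assms that by (simp add: power_less_one_iff)
    ultimately show False by simp
  qed
  then show ?thesis by (auto simp: qfact_def)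
qed


section \<open>Evaluation of polynomials\<close>

definition monom_eval :: "(nat \<Rightarrow>\<^sub>0 nat) \<Rightarrow> (nat \<Rightarrow> complex) \<Rightarrow> complex" where
  "monom_eval m x = (\<Prod>i\<in>Poly_Mapping.keys m. x i ^ Poly_Mapping.lookup m i)"

lemma monom_eval_superset:
  assumes "finite I" and "Poly_Mapping.keys m \<subseteq> I"
  shows "monom_eval m x = (\<Prod>i\<in>I. x i ^ Poly_Mapping.lookup m i)"
  unfolding monom_eval_def using assms by (intro prod.mono_neutral_left) (auto simp: in_keys_iff)

lemma monom_eval_add: "monom_eval (m + n) x = monom_eval m x * monom_eval n x"
proof -
  let ?I = "Poly_Mapping.keys m \<union> Poly_Mapping.keys n"
  have "monom_eval (m + n) x = (\<Prod>i\<in>?I. x i ^ Poly_Mapping.lookup (m + n) i)"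
    by (rule monom_eval_superset) (simp_all add: Poly_Mapping.keys_add)
  also have "\<dots> = monom_eval m x * monom_eval n x"
    by (simp add: monom_eval_superset[of ?I] lookup_add power_add prod.distrib)
  finally show ?thesis .
qed

text \<open>Cancellation may shrink the support of \<open>f + g\<close>; a common finite superset
  lets all evaluations be summed over one index set.\<close>

lemma poly_eval_superset:
  assumes "finite K" and "Poly_Mapping.keys f \<subseteq> K"
  shows "poly_eval f x = (\<Sum>m\<in>K. Poly_Mapping.lookup f m * monom_eval m x)"
  unfolding poly_eval_def monom_eval_def
  using assms by (intro sum.mono_neutral_left) (auto simp: in_keys_iff)

lemma poly_eval_zero [simp]: "poly_eval 0 x = 0"
  by (simp add: poly_eval_def)

lemma poly_eval_add: "poly_eval (f + g) x = poly_eval f x + poly_eval g x"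
proof -
  let ?K = "Poly_Mapping.keys f \<union> Poly_Mapping.keys g"
  have "poly_eval (f + g) x = (\<Sum>m\<in>?K. Poly_Mapping.lookup (f + g) m * monom_eval m x)"
    by (rule poly_eval_superset) (simp_all add: Poly_Mapping.keys_add)
  also have "\<dots> = poly_eval f x + poly_eval g x"
    by (simp add: poly_eval_superset[of ?K] lookup_add sum.distrib algebra_simps)
  finally show ?thesis .
qed

lemma poly_eval_diff: "poly_eval (f - g) x = poly_eval f x - poly_eval g x"
  using poly_eval_add[of "f - g" g x] by simp

lemma poly_eval_sum: "poly_eval (\<Sum>i\<in>I. f i) x = (\<Sum>i\<in>I. poly_eval (f i) x)"
  by (induction I rule: infinite_finite_induct) (auto simp: poly_eval_add)

lemma poly_eval_single [simp]: "poly_eval (Poly_Mapping.single m c) x = c * monom_eval m x"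
  by (simp add: poly_eval_superset[of "{m}"])

lemma poly_eval_scale:
  "poly_eval (Poly_Mapping.map (\<lambda>c. k * c) f) x = k * poly_eval f x"
proof -
  have "Poly_Mapping.lookup (Poly_Mapping.map (\<lambda>c. k * c) f) m = k * Poly_Mapping.lookup f m" for m
    by (simp add: Poly_Mapping.map.rep_eq when_def)
  moreover from this have "Poly_Mapping.keys (Poly_Mapping.map (\<lambda>c. k * c) f) \<subseteq> Poly_Mapping.keys f"
    by (auto simp: in_keys_iff)
  ultimately show ?thesis
    by (simp add: poly_eval_superset[of "Poly_Mapping.keys f"] sum_distrib_left mult.assoc)
qed

lemma poly_eval_mult: "poly_eval (f * g) x = poly_eval f x * poly_eval g x"
proof -
  have sum_single: "h = (\<Sum>m\<in>Poly_Mapping.keys h. Poly_Mapping.single m (Poly_Mapping.lookup h m))"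
    for h :: cpoly
    by (rule poly_mapping_eqI)
      (auto simp: lookup_sum lookup_single when_def in_keys_iff)
  have "f * g = (\<Sum>m\<in>Poly_Mapping.keys f. \<Sum>n\<in>Poly_Mapping.keys g.
      Poly_Mapping.single (m + n) (Poly_Mapping.lookup f m * Poly_Mapping.lookup g n))"
    by (subst sum_single[of f], subst sum_single[of g]) (simp add: sum_product mult_single)
  then have "poly_eval (f * g) x = (\<Sum>m\<in>Poly_Mapping.keys f. \<Sum>n\<in>Poly_Mapping.keys g.
      (Poly_Mapping.lookup f m * monom_eval m x) * (Poly_Mapping.lookup g n * monom_eval n x))"
    by (simp add: poly_eval_sum monom_eval_add mult_ac)
  then show ?thesis
    by (simp add: poly_eval_superset[OF _ order.refl] sum_product)
qed

section \<open>Digit expansions and the identity principle for polynomials\<close>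

lemma digit_sum_less:
  fixes a :: "nat \<Rightarrow> nat"
  assumes "\<And>i. i < n \<Longrightarrow> a i < b"
  shows "(\<Sum>i<n. a i * b ^ i) < b ^ n"
  using assms
proof (induction n)
  case (Suc n)
  have "Suc (a n) \<le> b" using Suc.prems[of n] by simp
  then have "Suc (a n) * b ^ n \<le> b * b ^ n" by (intro mult_right_mono) auto
  moreover have "(\<Sum>i<n. a i * b ^ i) < b ^ n" using Suc by simp
  ultimately show ?case by simp
qed simp

text \<open>The lower digits sum to less than \<open>b ^ n\<close>, so division by
  \<open>b ^ n\<close> recovers the leading one.\<close>

lemma digit_sum_inject:
  fixes a c :: "nat \<Rightarrow> nat"
  assumes "\<And>i. i < n \<Longrightarrow> a i < b" and "\<And>i. i < n \<Longrightarrow> c i < b"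
    and "(\<Sum>i<n. a i * b ^ i) = (\<Sum>i<n. c i * b ^ i)" and "i < n"
  shows "a i = c i"
  using assms
proof (induction n)
  case (Suc n)
  have low: "(\<Sum>i<n. a i * b ^ i) < b ^ n" "(\<Sum>i<n. c i * b ^ i) < b ^ n"
    using Suc.prems by (auto intro!: digit_sum_less)
  have nz: "b ^ n \<noteq> 0" using low by linarith
  have "(\<Sum>i<Suc n. a i * b ^ i) div b ^ n = a n" "(\<Sum>i<Suc n. c i * b ^ i) div b ^ n = c n"
    using low by (simp_all add: div_mult_self1[OF nz])
  then have "a n = c n" using Suc.prems(3) by simp
  then show ?case using Suc less_Suc_eq by auto
qed simp

text \<open>The Kronecker substitution \<open>x\<^sub>i = z^(b^i)\<close>, with \<open>b\<close> larger than all exponents, maps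
  distinct monomials to distinct powers of \<open>z\<close>.\<close>

lemma poly_eval_eq_0_imp_0:
  assumes vars: "\<And>m. m \<in> Poly_Mapping.keys f \<Longrightarrow> Poly_Mapping.keys m \<subseteq> {..<N}"
    and zero: "\<And>x. inj_on x {..<N} \<Longrightarrow> poly_eval f x = 0"
  shows "f = 0"
proof -
  let ?E = "\<Union>m\<in>Poly_Mapping.keys f. Poly_Mapping.lookup m ` {..<N}"
  \<comment> \<open>Including 1 in the maximum forces \<open>b \<ge> 2\<close>, so the powers
    \<open>b ^ i\<close> are distinct.\<close>
  define b where "b = Max (insert 1 ?E) + 1"
  have "finite (insert 1 ?E)" by simp
  then have b: "b \<ge> 2" "\<And>m i. m \<in> Poly_Mapping.keys f \<Longrightarrow> i < N \<Longrightarrow> Poly_Mapping.lookup m i < b"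
    unfolding b_def by (auto intro!: Max_ge le_imp_less_Suc simp del: Max_insert)
  define e where "e m = (\<Sum>i<N. Poly_Mapping.lookup m i * b ^ i)" for m :: "nat \<Rightarrow>\<^sub>0 nat"
  have inj: "inj_on e (Poly_Mapping.keys f)"
  proof
    fix m m' assume m: "m \<in> Poly_Mapping.keys f" "m' \<in> Poly_Mapping.keys f" "e m = e m'"
    show "m = m'"
    proof (rule poly_mapping_eqI)
      fix i
      show "Poly_Mapping.lookup m i = Poly_Mapping.lookup m' i"
      proof (cases "i < N")
        case True
        then show ?thesis
          using m b(2) digit_sum_inject[of N "Poly_Mapping.lookup m" b "Poly_Mapping.lookup m'" i]
          unfolding e_def by blast
      next
        case False
        then have "i \<notin> Poly_Mapping.keys m" "i \<notin> Poly_Mapping.keys m'" using vars m by fastforce+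
        then show ?thesis by (simp add: in_keys_iff)
      qed
    qed
  qed
  define p where "p = (\<Sum>m\<in>Poly_Mapping.keys f. monom (Poly_Mapping.lookup f m) (e m))"
  \<comment> \<open>At an integer \<open>k \<ge> 2\<close> the coordinates
    \<open>k ^ (b ^ i)\<close> are pairwise distinct, as \<open>zero\<close> requires, and
    infinitely many such \<open>k\<close> are available to force \<open>p = 0\<close>.\<close>
  have root: "poly p (of_nat k) = 0" if k: "k \<ge> 2" for k :: nat
  proof -
    define x where "x i = (of_nat k :: complex) ^ (b ^ i)" for i
    have "inj_on x {..<N}"
    proof
      fix i j assume "x i = x j"
      then have "of_nat (k ^ (b ^ i)) = (of_nat (k ^ (b ^ j)) :: complex)" by (simp add: x_def)
      then have "k ^ (b ^ i) = k ^ (b ^ j)" by (simp only: of_nat_eq_iff)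
      then show "i = j" using k b(1) by (simp add: power_inject_exp)
    qed
    then have "poly_eval f x = 0" by (rule zero)
    moreover have "poly_eval f x = poly p (of_nat k)"
      unfolding poly_eval_superset[OF finite_keys order.refl] p_def poly_sum
    proof (intro sum.cong refl)
      fix m assume "m \<in> Poly_Mapping.keys f"
      then have "monom_eval m x = of_nat k ^ e m"
        using vars by (simp add: monom_eval_superset[of "{..<N}"] x_def e_def power_sum mult.commute
            flip: power_mult)
      then show "Poly_Mapping.lookup f m * monom_eval m x =
          poly (monom (Poly_Mapping.lookup f m) (e m)) (of_nat k)"
        by (simp add: poly_monom)
    qed
    ultimately show ?thesis by simp
  qed
  have "p = 0"
  proof (rule ccontr)
    assume "p \<noteq> 0"
    then have "finite {z. poly p z = 0}" by (rule poly_roots_finite)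
    then have "finite ((of_nat :: nat \<Rightarrow> complex) ` {2..})"
      by (rule finite_subset[rotated]) (use root in auto)
    then show False by (simp add: finite_image_iff inj_on_def infinite_Ici)
  qed
  show "f = 0"
  proof (rule poly_mapping_eqI)
    fix m
    show "Poly_Mapping.lookup f m = Poly_Mapping.lookup 0 m"
    proof (cases "m \<in> Poly_Mapping.keys f")
      case True
      \<comment> \<open>Injectivity of \<open>e\<close> isolates the monomial \<open>m\<close> in
        this coefficient.\<close>
      have "0 = coeff p (e m)" using \<open>p = 0\<close> by simp
      also have "\<dots> = (\<Sum>m'\<in>Poly_Mapping.keys f. if m' = m then Poly_Mapping.lookup f m' else 0)"
        unfolding p_def coeff_sum using inj True
        by (intro sum.cong) (auto simp: inj_on_def)
      also have "\<dots> = Poly_Mapping.lookup f m" using True by simp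
      finally show ?thesis by simp
    qed (simp add: in_keys_iff)
  qed
qed

lemma poly_eval_inject:
  assumes "\<And>x. poly_eval f x = poly_eval g x"
  shows "f = g"
proof -
  obtain N where "\<Union>(Poly_Mapping.keys ` Poly_Mapping.keys (f - g)) \<subseteq> {..<N}"
    using finite_nat_iff_bounded[of "\<Union>(Poly_Mapping.keys ` Poly_Mapping.keys (f - g))"] by auto
  then have "f - g = 0"
    using assms by (intro poly_eval_eq_0_imp_0[of _ N]) (auto simp: poly_eval_diff)
  then show ?thesis by simp
qed

section \<open>Algebraic independence of the power sums\<close>

lemma sum_lessThan_add: "(\<Sum>i<m + n. g i) = (\<Sum>i<m. g i) + (\<Sum>j<n. g (m + j))"
  for g :: "nat \<Rightarrow> 'a::comm_monoid_add"
  by (induction n) (auto simp: add_ac)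

text \<open>A geometric sum whose ratio is an \<open>m\<close>-th root of unity; for
  \<open>0 < k \<le> m\<close> the ratio is 1 only at \<open>k = m\<close>.\<close>

lemma sum_powers_roots_unity:
  assumes "0 < k" and "k \<le> m"
  shows "(\<Sum>j<m. (exp (2 * of_real pi * \<i> / of_nat m) ^ j) ^ k) = (if k = m then of_nat m else (0 :: complex))"
proof -
  define w where "w = exp (2 * of_real pi * \<i> * of_nat k / of_nat m)"
  have "exp (2 * of_real pi * \<i> / of_nat m) ^ k = w"
    unfolding w_def exp_of_nat_mult[symmetric] by (simp add: mult_ac)
  then have eq: "(exp (2 * of_real pi * \<i> / of_nat m) ^ j) ^ k = w ^ j" for j
    by (metis power_mult mult.commute)
  have w1: "w = 1 \<longleftrightarrow> m dvd k"
    unfolding w_def using assms complex_root_unity_eq_1[of m k] by simp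
  have "(\<Sum>j<m. w ^ j) = (if k = m then of_nat m else 0)"
  proof (cases "k = m")
    case True
    then show ?thesis using w1 by simp
  next
    case False
    then have "w \<noteq> 1" using assms w1 by (auto dest: dvd_imp_le)
    moreover have "w ^ m = 1"
      unfolding w_def using assms complex_root_unity[of m k] by simp
    ultimately show ?thesis using False one_diff_power_eq[of w m] by simp
  qed
  then show ?thesis unfolding eq .
qed

text \<open>Appending the \<open>K + 1\<close> numbers \<open>y \<omega>\<^sup>j\<close>, with \<open>\<omega>\<close> a primitive root of unity of order \<open>K + 1\<close>,
  changes the power sum of degree \<open>K + 1\<close> but none of lower degree.\<close>

lemma power_sums_surj:
  obtains n and x :: "nat \<Rightarrow> complex"
  where "n \<ge> N" and "\<And>k. k < K \<Longrightarrow> (\<Sum>i<n. x i ^ (k + 1)) = a k"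
proof -
  have "\<exists>n\<ge>N. \<exists>x :: nat \<Rightarrow> complex. \<forall>k<K. (\<Sum>i<n. x i ^ (k + 1)) = a k"
  proof (induction K)
    case (Suc K)
    then obtain n and x :: "nat \<Rightarrow> complex"
      where n: "n \<ge> N" and x: "\<And>k. k < K \<Longrightarrow> (\<Sum>i<n. x i ^ (k + 1)) = a k" by blast
    define w where "w = exp (2 * of_real pi * \<i> / of_nat (Suc K))"
    \<comment> \<open>The appended numbers add \<open>Suc K * y ^ Suc K\<close> to the power sum of
      degree \<open>Suc K\<close>, so \<open>y\<close> is chosen to make up the missing
      amount.\<close>
    obtain y where y: "y ^ Suc K = (a K - (\<Sum>i<n. x i ^ (K + 1))) / of_nat (Suc K)"
      by (metis exists_complex_root nat.distinct(1))
    define x' where "x' i = (if i < n then x i else y * w ^ (i - n))" for i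
    have "(\<Sum>i<n + Suc K. x' i ^ (k + 1)) = a k" if k: "k < Suc K" for k
    proof -
      have "(\<Sum>i<n + Suc K. x' i ^ (k + 1)) =
          (\<Sum>i<n. x i ^ (k + 1)) + (\<Sum>j<Suc K. (y * w ^ j) ^ (k + 1))"
        unfolding sum_lessThan_add x'_def by simp
      also have "(\<Sum>j<Suc K. (y * w ^ j) ^ (k + 1)) = y ^ (k + 1) * (\<Sum>j<Suc K. (w ^ j) ^ (k + 1))"
        unfolding sum_distrib_left power_mult_distrib ..
      also have "(\<Sum>j<Suc K. (w ^ j) ^ (k + 1)) = (if k = K then of_nat (Suc K) else 0)"
        unfolding w_def using k sum_powers_roots_unity[of "k + 1" "Suc K"] by simp
      finally show ?thesis
        using y x[of k] k by (cases "k = K") (auto simp del: of_nat_Suc)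
    qed
    then show ?case using n by (intro exI[of _ "n + Suc K"]) auto
  qed auto
  then show ?thesis using that by blast
qed

text \<open>Only finitely many power sums occur in \<open>f\<close> and \<open>g\<close>, and
  \<open>power_sums_surj\<close> gives them arbitrary values. This yields uniqueness in the
  description of \<open>hl_P\<close>.\<close>

lemma power_sums_algebraically_independent:
  assumes "\<And>(n::nat) x. n \<ge> N \<Longrightarrow> poly_eval f (\<lambda>k. \<Sum>i<n. x i ^ (k + 1)) =
    poly_eval g (\<lambda>k. \<Sum>i<n. x i ^ (k + 1))"
  shows "f = g"
proof (rule poly_eval_inject)
  fix a :: "nat \<Rightarrow> complex"
  let ?V = "\<Union>(Poly_Mapping.keys ` (Poly_Mapping.keys f \<union> Poly_Mapping.keys g))"
  obtain K where K: "?V \<subseteq> {..<K}"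
    using finite_nat_iff_bounded[of ?V] by auto
  obtain n :: nat and x :: "nat \<Rightarrow> complex" where n: "n \<ge> N" and x: "\<And>k. k < K \<Longrightarrow> (\<Sum>i<n. x i ^ (k + 1)) = a k"
    using power_sums_surj[where N = N and K = K and a = a] by metis
  have "poly_eval h a = poly_eval h (\<lambda>k. \<Sum>i<n. x i ^ (k + 1))" if "h \<in> {f, g}" for h
    unfolding poly_eval_def
  proof (intro sum.cong refl arg_cong2[where f = "(*)"] prod.cong arg_cong2[where f = "(^)"])
    fix m i assume "m \<in> Poly_Mapping.keys h" "i \<in> Poly_Mapping.keys m"
    then have "i < K" using K that by blast
    then show "a i = (\<Sum>j<n. x j ^ (i + 1))" using x by simp
  qed
  then show "poly_eval f a = poly_eval g a" using assms[OF n, of x] by simp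
qed


section \<open>Elementary symmetric functions and power sums\<close>

text \<open>Newton's recursion for the elementary symmetric functions, with \<open>a k\<close> in
  the role of the power sum of degree \<open>k + 1\<close>.\<close>

fun newton_e :: "nat \<Rightarrow> (nat \<Rightarrow> 'a::field_char_0) \<Rightarrow> 'a" where
  "newton_e 0 a = 1"
| "newton_e (Suc n) a = (\<Sum>i=0..n. newton_e i a * ((-1) ^ (n - i) * a (n - i))) / of_nat (Suc n)"

text \<open>Newton's identities state that the generating function \<open>F\<close> of the elementary symmetric
  functions satisfies \<open>F' = F * (\<Sum>\<^sub>k (-1)\<^sup>k p\<^bsub>k+1\<^esub> z\<^sup>k)\<close>.\<close>

lemma newton_e_eqI:
  assumes "fps_nth F 0 = 1" and "fps_deriv F = F * Abs_fps (\<lambda>k. (-1) ^ k * a k)"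
  shows "fps_nth F n = newton_e n a"
proof (induction n rule: less_induct)
  case (less n)
  show ?case
  proof (cases n)
    case 0
    then show ?thesis using assms(1) by simp
  next
    case (Suc m)
    have "of_nat (Suc m) * fps_nth F (Suc m) = fps_nth (fps_deriv F) m" by simp
    also have "\<dots> = (\<Sum>i=0..m. fps_nth F i * ((-1) ^ (m - i) * a (m - i)))"
      unfolding assms(2) by (simp add: fps_mult_nth)
    also have "\<dots> = (\<Sum>i=0..m. newton_e i a * ((-1) ^ (m - i) * a (m - i)))"
      using less Suc by (intro sum.cong) auto
    finally show ?thesis unfolding Suc by (simp add: field_simps del: of_nat_Suc)
  qed
qed

lemma esym_fps:
  assumes "finite A"
  shows "fps_nth (\<Prod>i\<in>A. 1 + fps_const (x i) * fps_X) n = esym n A (x :: 'b \<Rightarrow> 'a::comm_ring_1)"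
proof -
  have "(\<Prod>i\<in>A. fps_const (x i) * fps_X + 1) = (\<Sum>S\<in>Pow A. fps_const (\<Prod>i\<in>S. x i) * fps_X ^ card S)"
    unfolding prod_add[OF assms]
  proof (intro sum.cong refl)
    fix S
    have "(\<Prod>i\<in>S. fps_const (x i)) = fps_const (\<Prod>i\<in>S. x i)"
      by (induction S rule: infinite_finite_induct) auto
    then show "(\<Prod>i\<in>S. fps_const (x i) * fps_X) * (\<Prod>i\<in>A - S. 1) =
        fps_const (\<Prod>i\<in>S. x i) * fps_X ^ card S"
      by (simp add: prod.distrib)
  qed
  then have "fps_nth (\<Prod>i\<in>A. 1 + fps_const (x i) * fps_X) n =
      (\<Sum>S\<in>Pow A. if card S = n then \<Prod>i\<in>S. x i else 0)"
    by (simp add: fps_sum_nth add.commute fps_X_power_nth if_distrib eq_commute cong: if_cong)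
  also have "\<dots> = esym n A x"
    using assms unfolding esym_def by (subst sum.inter_filter[symmetric]) auto
  finally show ?thesis .
qed

text \<open>The series \<open>P\<close> is the logarithmic derivative of \<open>F\<close>: a further
  variable multiplies \<open>F\<close> by 1 + x_a z and adds x_a / (1 + x_a z) to
  \<open>P\<close>.\<close>

lemma newton_e_power_sums:
  fixes x :: "'b \<Rightarrow> 'a::field_char_0"
  assumes "finite A"
  shows "newton_e n (\<lambda>k. \<Sum>i\<in>A. x i ^ (k + 1)) = esym n A x"
proof -
  define P where "P A = Abs_fps (\<lambda>k. (-1) ^ k * (\<Sum>i\<in>A. x i ^ (k + 1)))" for A
  define F where "F A = (\<Prod>i\<in>A. 1 + fps_const (x i) * fps_X)" for A
  have "fps_deriv (F A) = F A * P A"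
    using assms
  proof (induction A)
    case empty
    then show ?case by (simp add: F_def P_def fps_eq_iff)
  next
    case (insert a A)
    have F: "F (insert a A) = (1 + fps_const (x a) * fps_X) * F A"
      using insert by (simp add: F_def)
    have "(1 + fps_const (x a) * fps_X) * P {a} = fps_const (x a)"
    proof (rule fps_ext)
      fix k
      show "fps_nth ((1 + fps_const (x a) * fps_X) * P {a}) k = fps_nth (fps_const (x a)) k"
        by (cases k) (auto simp: P_def algebra_simps)
    qed
    moreover have "P (insert a A) = P {a} + P A"
      using insert by (simp add: P_def fps_eq_iff algebra_simps)
    moreover have "fps_deriv (F (insert a A)) =
      fps_const (x a) * F A + (1 + fps_const (x a) * fps_X) * (F A * P A)"
      unfolding F using insert.IH by (simp add: algebra_simps)
    moreover have "F (insert a A) * (P {a} + P A) =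
      ((1 + fps_const (x a) * fps_X) * P {a}) * F A + (1 + fps_const (x a) * fps_X) * (F A * P A)"
      unfolding F by (simp only: algebra_simps)
    ultimately show ?case by simp
  qed
  moreover have "fps_nth (F A) 0 = 1"
    unfolding F_def by (induction A rule: infinite_finite_induct) auto
  ultimately have "fps_nth (F A) n = newton_e n (\<lambda>k. \<Sum>i\<in>A. x i ^ (k + 1))"
    unfolding P_def by (intro newton_e_eqI)
  then show ?thesis unfolding F_def using esym_fps[OF assms] by metis
qed

text \<open>Under the specialisation the series of signed power sums is y + 1 / (1 + z), the
  logarithmic derivative of (1 + z) exp (y z).\<close>

lemma newton_e_gamma_alpha:
  fixes y :: "'a::field_char_0"
  shows "newton_e n (\<lambda>k. if k = 0 then 1 + y else 1) =
    y ^ n / fact n + (if n \<ge> 1 then y ^ (n - 1) / fact (n - 1) else 0)"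
proof -
  define F where "F = (1 + fps_X) * fps_exp y"
  have alt: "(1 + fps_X) * Abs_fps (\<lambda>k. (-1) ^ k) = (1 :: 'a fps)"
  proof (rule fps_ext)
    fix k show "fps_nth ((1 + fps_X) * Abs_fps (\<lambda>k. (-1) ^ k)) k = fps_nth (1 :: 'a fps) k"
      by (cases k) (auto simp: algebra_simps)
  qed
  have "Abs_fps (\<lambda>k. (-1) ^ k * (if k = 0 then 1 + y else 1)) = fps_const y + Abs_fps (\<lambda>k. (-1) ^ k)"
    by (simp add: fps_eq_iff)
  moreover have "fps_deriv F = fps_exp y + (1 + fps_X) * (fps_const y * fps_exp y)"
    by (simp add: F_def algebra_simps)
  moreover have "F * (fps_const y + Abs_fps (\<lambda>k. (-1) ^ k)) =
      (1 + fps_X) * (fps_const y * fps_exp y) + ((1 + fps_X) * Abs_fps (\<lambda>k. (-1) ^ k)) * fps_exp y"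
    unfolding F_def by (simp only: algebra_simps)
  ultimately have "fps_deriv F = F * Abs_fps (\<lambda>k. (-1) ^ k * (if k = 0 then 1 + y else 1))"
    unfolding alt by simp
  then have "fps_nth F n = newton_e n (\<lambda>k. if k = 0 then 1 + y else 1)"
    by (intro newton_e_eqI) (auto simp: F_def)
  moreover have "fps_nth F n = y ^ n / fact n + (if n \<ge> 1 then y ^ (n - 1) / fact (n - 1) else 0)"
    by (cases n) (auto simp: F_def distrib_right)
  ultimately show ?thesis by simp
qed

text \<open>Provides the witness for the definite description in \<open>hl_P\<close>; the recursion
  only adds, multiplies and divides by nonzero integers.\<close>

lemma newton_e_poly: "\<exists>f. \<forall>a. poly_eval f a = newton_e n a"
proof (induction n rule: less_induct)
  case (less n)
  show ?case
  proof (cases n)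
    case 0
    then have "\<forall>a. poly_eval (Poly_Mapping.single 0 1) a = newton_e n a"
      by (simp only: poly_eval_single) (simp add: monom_eval_def)
    then show ?thesis by blast
  next
    case (Suc m)
    from less obtain g where g: "\<And>i a. i < n \<Longrightarrow> poly_eval (g i) a = newton_e i a"
      by metis
    define f where "f = (\<Sum>i=0..m. g i *
      Poly_Mapping.single (Poly_Mapping.single (m - i) 1) ((-1) ^ (m - i) / of_nat (Suc m)))"
    have "poly_eval f a = newton_e n a" for a
      unfolding f_def poly_eval_sum poly_eval_mult Suc newton_e.simps sum_divide_distrib
      using g Suc by (intro sum.cong) (auto simp: monom_eval_def)
    then show ?thesis by blast
  qed
qed

section \<open>Hall-Littlewood functions of a column and their specialisation\<close>

definition indicator_exponent :: "nat set \<Rightarrow> nat \<Rightarrow>\<^sub>0 nat" where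
  "indicator_exponent S = (\<Sum>i\<in>S. Poly_Mapping.single i 1)"

lemma lookup_indicator_exponent:
  assumes "finite S"
  shows "Poly_Mapping.lookup (indicator_exponent S) i = (if i \<in> S then 1 else 0)"
  using assms by (simp add: indicator_exponent_def lookup_sum lookup_single when_def)

lemma keys_indicator_exponent: "finite S \<Longrightarrow> Poly_Mapping.keys (indicator_exponent S) = S"
  by (auto simp: in_keys_iff lookup_indicator_exponent split: if_splits)

text \<open>By \<open>hl_sum_ones\<close> the sum \<open>F\<close> of the squarefree monomials of
  degree \<open>n\<close> satisfies the defining description, with a product of two t-factorials as
  normalisation.\<close>

lemma hl_poly_ones_eval:
  assumes "norm t < 1" and "n \<le> N"
  shows "poly_eval (hl_poly N (replicate n 1) t) x = esym n {..<N} x"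
proof -
  define I where "I = {S. S \<subseteq> {..<N} \<and> card S = n}"
  have fin: "finite I" "\<And>S. S \<in> I \<Longrightarrow> finite S"
    unfolding I_def by (auto intro: finite_subset)
  define F :: cpoly where "F = (\<Sum>S\<in>I. Poly_Mapping.single (indicator_exponent S) 1)"
  have eval: "poly_eval F x = esym n {..<N} x" for x
    unfolding F_def poly_eval_sum esym_def I_def[symmetric]
    using fin(2) by (intro sum.cong refl)
      (simp add: monom_eval_def keys_indicator_exponent lookup_indicator_exponent)
  define \<mu> :: "nat \<Rightarrow>\<^sub>0 nat" where "\<mu> = Poly_Mapping.nth (replicate n 1)"
  have \<mu>: "\<mu> = indicator_exponent {..<n}"
    unfolding \<mu>_def by (rule poly_mapping_eqI) (simp add: lookup_indicator_exponent nth_default_def)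
  have "{..<n} \<in> I" using assms(2) by (auto simp: I_def)
  have lead: "Poly_Mapping.lookup F \<mu> = 1"
  proof -
    have "indicator_exponent S = \<mu> \<longleftrightarrow> S = {..<n}" if "S \<in> I" for S
      unfolding \<mu> using fin(2)[OF that] by (metis keys_indicator_exponent finite_lessThan)
    then have "Poly_Mapping.lookup F \<mu> = (\<Sum>S\<in>I. if S = {..<n} then 1 else 0)"
      unfolding F_def lookup_sum lookup_single when_def by (intro sum.cong) auto
    then show ?thesis using fin \<open>{..<n} \<in> I\<close> by simp
  qed
  have vars: "Poly_Mapping.keys m \<subseteq> {..<N}" if "m \<in> Poly_Mapping.keys F" for m
  proof -
    have "m \<in> indicator_exponent ` I"
      using that subsetD[OF keys_sum[of "\<lambda>S. Poly_Mapping.single (indicator_exponent S) (1 :: complex)" I]]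
      unfolding F_def by fastforce
    then obtain S where "S \<in> I" "m = indicator_exponent S" by blast
    then show ?thesis using fin(2)[of S] by (simp add: keys_indicator_exponent I_def)
  qed
  define v where "v = qfact t n * qfact t (N - n)"
  have v: "v \<noteq> 0" unfolding v_def using qfact_nonzero[OF assms(1)] by simp
  have "t \<noteq> 1" using assms(1) by auto
  then have hl: "hl_sum N (replicate n 1) t x = v * poly_eval F x" if "inj_on x {..<N}" for x
    unfolding eval v_def using that assms by (intro hl_sum_ones)
  have "hl_poly N (replicate n 1) t = F"
    unfolding hl_poly_def \<mu>_def[symmetric]
  proof (intro the_equality conjI)
    show "\<forall>m\<in>Poly_Mapping.keys F. Poly_Mapping.keys m \<subseteq> {..<N}" using vars by blast
    show "Poly_Mapping.lookup F \<mu> = 1" by fact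
    show "\<exists>v. v \<noteq> 0 \<and> (\<forall>x. inj_on x {..<N} \<longrightarrow> poly_eval F x = 1 / v * hl_sum N (replicate n 1) t x)"
      using v hl by (intro exI[of _ v]) auto
  next
    fix g
    assume g: "(\<forall>m\<in>Poly_Mapping.keys g. Poly_Mapping.keys m \<subseteq> {..<N}) \<and>
      Poly_Mapping.lookup g \<mu> = 1 \<and>
      (\<exists>v. v \<noteq> 0 \<and> (\<forall>x. inj_on x {..<N} \<longrightarrow> poly_eval g x = 1 / v * hl_sum N (replicate n 1) t x))"
    then obtain w where w: "\<And>x. inj_on x {..<N} \<Longrightarrow> poly_eval g x = 1 / w * hl_sum N (replicate n 1) t x"
      by blast
    \<comment> \<open>Another candidate \<open>g\<close> is proportional to \<open>F\<close> at all
      points with distinct coordinates, hence identically; the coefficient at \<open>\<mu>\<close>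
      is 1 in both, so the ratio is 1.\<close>
    define h where "h = g - Poly_Mapping.map (\<lambda>c. v / w * c) F"
    have lookup_h: "Poly_Mapping.lookup h m = Poly_Mapping.lookup g m - v / w * Poly_Mapping.lookup F m" for m
      by (simp add: h_def lookup_minus Poly_Mapping.map.rep_eq when_def)
    have "h = 0"
    proof (rule poly_eval_eq_0_imp_0)
      fix m assume "m \<in> Poly_Mapping.keys h"
      then have "m \<in> Poly_Mapping.keys g \<or> m \<in> Poly_Mapping.keys F"
        by (auto simp: in_keys_iff lookup_h)
      then show "Poly_Mapping.keys m \<subseteq> {..<N}" using g vars by blast
    next
      fix x :: "nat \<Rightarrow> complex" assume "inj_on x {..<N}"
      then show "poly_eval h x = 0"
        unfolding h_def poly_eval_diff poly_eval_scale by (simp only: w hl) simp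
    qed
    then have lookup_g: "Poly_Mapping.lookup g m = v / w * Poly_Mapping.lookup F m" for m
      using lookup_h[of m] by simp
    from lookup_g[of \<mu>] have "v / w = 1" using lead g by simp
    then show "g = F" using lookup_g by (intro poly_mapping_eqI) simp
  qed
  then show ?thesis using eval by simp
qed

text \<open>In \<open>n\<close> or more variables the Newton polynomial in the power sums is the
  elementary symmetric polynomial, so it meets the description; algebraic independence excludes any
  other.\<close>

lemma hl_P_ones_eval:
  assumes "norm t < 1"
  shows "poly_eval (hl_P (replicate n 1) t) a = newton_e n a"
proof -
  obtain f where f: "\<And>a. poly_eval f a = newton_e n a"
    using newton_e_poly[of n] by blast
  have "hl_P (replicate n 1) t = f"
    unfolding hl_P_def
  proof (rule the_equality)
    show "\<forall>N\<ge>length (replicate n 1). \<forall>x. poly_eval f (\<lambda>k. \<Sum>i<N. x i ^ (k + 1)) =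
        poly_eval (hl_poly N (replicate n 1) t) x"
      using assms by (auto simp: f newton_e_power_sums[simplified] hl_poly_ones_eval[simplified])
  next
    fix g
    assume "\<forall>N\<ge>length (replicate n 1). \<forall>x. poly_eval g (\<lambda>k. \<Sum>i<N. x i ^ (k + 1)) =
        poly_eval (hl_poly N (replicate n 1) t) x"
    then show "g = f"
      using assms
      by (intro power_sums_algebraically_independent[of n])
        (auto simp: f newton_e_power_sums[simplified] hl_poly_ones_eval[simplified])
  qed
  then show ?thesis using f by simp
qed

lemma Q_spec_ones:
  assumes "norm t < 1"
  shows "Q_spec (replicate n 1) \<tau> t = qpoch t t n *
    ((\<tau> / (1 - t)) ^ n / fact n + (if n \<ge> 1 then (\<tau> / (1 - t)) ^ (n - 1) / fact (n - 1) else 0))"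
proof -
  \<comment> \<open>For \<open>n = 0\<close> the product is empty; otherwise the only part is 1,
    with multiplicity \<open>n\<close>.\<close>
  have "(\<Prod>i\<in>set (replicate n (1 :: nat)). qpoch t t (count_list (replicate n 1) i)) = qpoch t t n"
  proof (cases n)
    case (Suc m)
    have "count_list (replicate k 1) (1::nat) = k" for k by (induction k) auto
    then show ?thesis using Suc by (simp add: set_replicate_conv_if)
  qed (simp add: qpoch_def)
  then show ?thesis
    unfolding Q_spec_def hl_Q_def poly_eval_scale hl_P_ones_eval[OF assms] newton_e_gamma_alpha
    by simp
qed

text \<open>For \<open>n = 0\<close> the maximum is 0 and both sides are empty, which covers the
  later case \<open>i + m = 0\<close>.\<close>

lemma conjugate_singleton: "conjugate [n] = replicate n 1"
proof -
  have "map (\<lambda>j. length (filter (\<lambda>a. j \<le> a) [n])) [1..<Suc n] = map (\<lambda>j. 1) [1..<Suc n]"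
    by (intro map_cong) auto
  then show ?thesis by (simp add: conjugate_def map_replicate_const)
qed


section \<open>The law on two-row signatures\<close>

lemma qpoch_Suc: "qpoch a t (Suc n) = qpoch a t n * (1 - a * t ^ n)"
  by (simp add: qpoch_def)

lemma of_real_qpoch: "qpoch (of_real a) (of_real t) n = complex_of_real (qpoch a t n)"
  by (simp add: qpoch_def)

lemma qpoch_pos:
  fixes t :: real
  assumes "0 < t" and "t < 1"
  shows "qpoch t t n > 0"
proof (induction n)
  case (Suc n)
  have "t ^ Suc n < 1" using assms by (intro power_Suc_less_one) auto
  then show ?case using Suc by (simp add: qpoch_Suc)
qed (simp add: qpoch_def)

lemma qpoch_add_le:
  fixes t :: real
  assumes "0 < t" and "t < 1"
  shows "qpoch t t (m + i) \<le> qpoch t t m"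
proof (induction i)
  case (Suc i)
  have "qpoch t t (m + Suc i) \<le> qpoch t t (m + i) * 1"
    unfolding add_Suc_right qpoch_Suc
    using qpoch_pos[OF assms, of "m + i"] assms by (intro mult_left_mono) auto
  then show ?case using Suc by simp
qed simp

lemma two_times_choose_two: "2 * int (n choose 2) = int n * (int n - 1)"
  by (induction n) (auto simp: numeral_2_eq_2 algebra_simps)

text \<open>The two binomials are the exponents of \<open>t\<close> contributed by L_1 - d = m + x
  and L_2 - d = m.\<close>

lemma choose_two_add_choose_two:
  "int ((m + x choose 2) + (m choose 2)) = int m ^ 2 + (int x - 1) * int m + int (x choose 2)"
  using two_times_choose_two[of "m + x"] two_times_choose_two[of m] two_times_choose_two[of x]
  by (simp add: power2_eq_square algebra_simps)

text \<open>A single term of a series with nonnegative terms is at most its sum. The bound is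
  uniform in \<open>y\<close>, which in the application grows with \<open>m\<close>.\<close>

lemma exp_minus_times_power_le:
  fixes y :: real
  assumes "y \<ge> 0"
  shows "exp (- y) * (y ^ k / fact k) \<le> 1"
proof -
  have "(\<Sum>n\<in>{k}. y ^ n / fact n) \<le> suminf (\<lambda>n. y ^ n / fact n)"
    using assms summable_exp[of y] by (intro sum_le_suminf) (auto simp: field_simps)
  also have "\<dots> = exp y"
    by (simp add: exp_def scaleR_conv_of_real divide_inverse_commute)
  finally show ?thesis by (simp add: exp_minus field_simps)
qed

text \<open>The contribution of d = L - m. Integer powers are used because \<open>L - int m\<close>
  can be negative.\<close>

definition two_row_term :: "real \<Rightarrow> real \<Rightarrow> int \<Rightarrow> nat \<Rightarrow> nat \<Rightarrow> real" where
  "two_row_term t chi L x m =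
     exp (- chi * t powi (L - int m)) * (-1) ^ m *
     t powi (int m ^ 2 + (int x - 1) * int m + int (x choose 2)) *
     (\<Sum>i=0..x. (-1) ^ (x - i) / qpoch t t (x - i) * qbinom t (m + i) i *
        ((t powi (L - int m) * chi) ^ (i + m) / fact (i + m) +
         (if i + m \<ge> 1
          then (t powi (L - int m) * chi) ^ (i + m - 1) / fact (i + m - 1) else 0)))"

text \<open>The exponential absorbs the powers of \<open>y\<close>, the ratio of Pochhammer symbols
  depending on \<open>m\<close> is at most 1, and the exponent of \<open>t\<close> is at least
  \<open>m - 1\<close>; a geometric series dominates.\<close>

lemma abs_two_row_term_le:
  assumes t: "0 < t" "t < 1" and chi: "chi > 0"
  shows "\<bar>two_row_term t chi L x m\<bar> \<le>
    (\<Sum>i=0..x. 2 / (qpoch t t (x - i) * qpoch t t i)) / t * t ^ m"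
proof -
  define y where "y = t powi (L - int m) * chi"
  have y: "y \<ge> 0" unfolding y_def using t chi by simp
  define e where "e = int m ^ 2 + (int x - 1) * int m + int (x choose 2)"
  define g where "g i = y ^ (i + m) / fact (i + m) +
    (if i + m \<ge> 1 then y ^ (i + m - 1) / fact (i + m - 1) else 0)" for i
  define c where "c i = (-1) ^ (x - i) / qpoch t t (x - i) * qbinom t (m + i) i" for i
  have g: "exp (- y) * \<bar>g i\<bar> \<le> 2" for i
  proof -
    have "g i \<ge> 0" unfolding g_def using y by auto
    moreover have "exp (- y) * g i \<le> 1 + 1"
      unfolding g_def distrib_left
      by (intro add_mono exp_minus_times_power_le y)
        (use exp_minus_times_power_le[OF y] in auto)
    ultimately show ?thesis by simp
  qed
  have c: "\<bar>c i\<bar> \<le> 1 / (qpoch t t (x - i) * qpoch t t i)" for i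
  proof -
    have "\<bar>c i\<bar> = 1 / (qpoch t t (x - i) * qpoch t t i) * (qpoch t t (m + i) / qpoch t t m)"
      unfolding c_def qbinom_def using qpoch_pos[OF t] by (simp add: abs_mult power_abs less_imp_le)
    also have "\<dots> \<le> 1 / (qpoch t t (x - i) * qpoch t t i) * 1"
      using qpoch_add_le[OF t, of m i] qpoch_pos[OF t] by (intro mult_left_mono) (auto simp: less_imp_le)
    finally show ?thesis by simp
  qed
  \<comment> \<open>Writing m^2 - m as (m - 1)^2 + (m - 1) bounds the exponent below by m - 1 for
    every m, including 0; this is the source of the factor 1 / t.\<close>
  have "e = (int m - 1)\<^sup>2 + (int m - 1) + int x * int m + int (x choose 2)"
    unfolding e_def by (simp add: power2_eq_square algebra_simps)
  then have "e \<ge> int m - 1" by simp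
  then have "t powi e \<le> t powi (int m - 1)" using t by (intro power_int_decreasing) auto
  also have "\<dots> = t ^ m / t" using t by (simp add: power_int_diff)
  finally have e: "t powi e \<le> t ^ m / t" .
  have "two_row_term t chi L x m = (-1) ^ m * (t powi e * (exp (- y) * (\<Sum>i=0..x. c i * g i)))"
    unfolding two_row_term_def e_def y_def c_def g_def by (simp add: mult_ac)
  then have "\<bar>two_row_term t chi L x m\<bar> = t powi e * (exp (- y) * \<bar>\<Sum>i=0..x. c i * g i\<bar>)"
    using t by (simp add: abs_mult power_abs)
  also have "\<dots> \<le> t powi e * (exp (- y) * (\<Sum>i=0..x. \<bar>c i\<bar> * \<bar>g i\<bar>))"
    using t by (intro mult_left_mono order.trans[OF sum_abs]) (auto simp: abs_mult)
  also have "\<dots> = t powi e * (\<Sum>i=0..x. \<bar>c i\<bar> * (exp (- y) * \<bar>g i\<bar>))"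
    by (simp add: sum_distrib_left mult_ac)
  also have "\<dots> \<le> t powi e * (\<Sum>i=0..x. 1 / (qpoch t t (x - i) * qpoch t t i) * 2)"
    using t c g qpoch_pos[OF t] by (intro mult_left_mono sum_mono mult_mono) (auto simp: less_imp_le)
  also have "\<dots> \<le> t ^ m / t * (\<Sum>i=0..x. 1 / (qpoch t t (x - i) * qpoch t t i) * 2)"
    using e qpoch_pos[OF t] by (intro mult_right_mono sum_nonneg) (auto simp: less_imp_le)
  finally show ?thesis by (simp add: mult_ac)
qed

lemma summable_abs_two_row_term:
  assumes "0 < t" and "t < 1" and "chi > 0"
  shows "summable (\<lambda>m. \<bar>two_row_term t chi L x m\<bar>)"
proof (rule summable_comparison_test')
  show "summable (\<lambda>m. (\<Sum>i=0..x. 2 / (qpoch t t (x - i) * qpoch t t i)) / t * t ^ m)"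
    using assms by (intro summable_mult summable_geometric) auto
  show "norm \<bar>two_row_term t chi L x m\<bar> \<le>
      (\<Sum>i=0..x. 2 / (qpoch t t (x - i) * qpoch t t i)) / t * t ^ m" if "m \<ge> 0" for m
    using abs_two_row_term_le[OF assms] by simp
qed

section \<open>Evaluation of the mass function at two-row signatures\<close>

lemma interlacing_two_row:
  "{\<mu> \<in> Sig 1. interlacing \<mu> [L + int x, L]} = (\<lambda>i. [L + int i]) ` {0..x}"
proof safe
  fix \<mu> assume \<mu>: "\<mu> \<in> Sig 1" "interlacing \<mu> [L + int x, L]"
  then obtain a where a: "\<mu> = [a]" by (auto simp: Sig_def length_Suc_conv)
  then have "L \<le> a" "a \<le> L + int x" using \<mu> by (auto simp: interlacing_def)
  then have "\<mu> = [L + int (nat (a - L))]" "nat (a - L) \<in> {0..x}" using a by auto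
  then show "\<mu> \<in> (\<lambda>i. [L + int i]) ` {0..x}" by blast
qed (auto simp: Sig_def interlacing_def)

lemma law_mass_two_row:
  assumes t: "0 < t" "t < 1" and chi: "chi > 0"
  shows "law_mass 2 t chi [L + int x, L] =
    complex_of_real (1 / qpoch_inf t t * suminf (two_row_term t chi L x))"
proof -
  \<comment> \<open>\<open>T\<close> repeats the summand of \<open>law_mass\<close> without
    simplification, so that unfolding both definitions at the end aligns them.\<close>
  define T where "T d =
        complex_of_real
          (exp (- chi * t powi d) *
           (t ^ (\<Sum>i<2. nat ([L + int x, L] ! i - d) choose 2) /
            (qpoch t t (nat ([L + int x, L] ! (2 - 1) - d)) *
             (\<Prod>i<2 - 1. qpoch t t (nat ([L + int x, L] ! i - [L + int x, L] ! Suc i)))))) *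
        (\<Sum>\<mu>\<in>{\<mu>\<in>Sig (2 - 1). interlacing \<mu> [L + int x, L]}.
           (-1) powi (sum_list [L + int x, L] - sum_list \<mu> - d) *
           complex_of_real
             (\<Prod>i<2 - 1. qbinom t (nat ([L + int x, L] ! i - [L + int x, L] ! Suc i))
               (nat ([L + int x, L] ! i - \<mu> ! i))) *
           Q_spec (conjugate (map (\<lambda>a. nat (a - d)) \<mu>))
             (complex_of_real ((1 - t) * t powi d * chi)) (complex_of_real t))" for d
  have T: "T (L - int m) = complex_of_real (two_row_term t chi L x m)" for m
  proof -
    define y where "y = t powi (L - int m) * chi"
    define g where "g i = y ^ (i + m) / fact (i + m) +
      (if i + m \<ge> 1 then y ^ (i + m - 1) / fact (i + m - 1) else 0)" for i
    define A where "A = exp (- chi * t powi (L - int m)) *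
      (t ^ ((m + x choose 2) + (m choose 2)) / (qpoch t t m * qpoch t t x))"
    have Q: "Q_spec (replicate (i + m) 1) (complex_of_real ((1 - t) * t powi (L - int m) * chi))
        (complex_of_real t) = complex_of_real (qpoch t t (i + m) * g i)" for i
    proof -
      \<comment> \<open>The factor 1 - t of the parameter cancels the denominator in the image of
        p_1.\<close>
      have "complex_of_real ((1 - t) * t powi (L - int m) * chi) / (1 - complex_of_real t) = of_real y"
        unfolding y_def using t by simp
      then show ?thesis
        using t by (subst Q_spec_ones) (auto simp: of_real_qpoch g_def)
    qed
    have "T (L - int m) = complex_of_real A * (\<Sum>i=0..x.
        (-1) powi (int (m + x) - int i) * complex_of_real (qbinom t x (x - i)) *
        complex_of_real (qpoch t t (i + m) * g i))"
    proof -
      have inj: "inj_on (\<lambda>i. [L + int i]) {0..x}" by (auto simp: inj_on_def)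
      have set: "{\<mu> \<in> Sig (2 - 1). interlacing \<mu> [L + int x, L]} = (\<lambda>i. [L + int i]) ` {0..x}"
        using interlacing_two_row by simp
      have nat: "nat (L + int k - (L - int m)) = k + m" for k by simp
      have sgn: "sum_list [L + int x, L] - sum_list [L + int i] - (L - int m) = int (m + x) - int i" for i
        by simp
      have conj: "conjugate (map (\<lambda>a. nat (a - (L - int m))) [L + int i]) = replicate (i + m) 1" for i
        unfolding list.map nat by (rule conjugate_singleton)
      have "t ^ (\<Sum>i<2. nat ([L + int x, L] ! i - (L - int m)) choose 2) /
            (qpoch t t (nat ([L + int x, L] ! (2 - 1) - (L - int m))) *
             (\<Prod>i<2 - 1. qpoch t t (nat ([L + int x, L] ! i - [L + int x, L] ! Suc i)))) =
          t ^ ((m + x choose 2) + (m choose 2)) / (qpoch t t m * qpoch t t x)"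
        using nat[of x] by (simp add: numeral_2_eq_2 add.commute)
      moreover have "(\<Prod>j<2 - 1. qbinom t (nat ([L + int x, L] ! j - [L + int x, L] ! Suc j))
               (nat ([L + int x, L] ! j - [L + int i] ! j))) = qbinom t x (x - i)" for i
        by (simp add: nat_minus_as_int)
      ultimately show ?thesis
        unfolding T_def set sum.reindex[OF inj] comp_def conj sgn Q A_def by (simp only:)
    qed
    also have "\<dots> = complex_of_real (A * (\<Sum>i=0..x.
        (-1) ^ m * (-1) ^ (x - i) * qbinom t x (x - i) * (qpoch t t (i + m) * g i)))"
    proof -
      \<comment> \<open>The sign exponent |L| - |\<mu>| - d is m + x - i, nonnegative for i \<le> x,
        so the integer power becomes a natural one.\<close>
      have "(-1) powi (int (m + x) - int i) = complex_of_real ((-1) ^ m * (-1) ^ (x - i))" if "i \<le> x" for i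
      proof -
        have "int (m + x) - int i = int (m + (x - i))" using that by simp
        then show ?thesis by (simp only: power_int_of_nat power_add of_real_mult of_real_power of_real_minus of_real_1)
      qed
      then show ?thesis
        unfolding of_real_mult[of A] of_real_sum
        by (intro arg_cong2[where f = "(*)"] sum.cong refl) simp
    qed
    also have "A * (\<Sum>i=0..x. (-1) ^ m * (-1) ^ (x - i) * qbinom t x (x - i) * (qpoch t t (i + m) * g i)) =
        two_row_term t chi L x m"
    proof -
      have e: "t powi (int m ^ 2 + (int x - 1) * int m + int (x choose 2)) =
          t ^ ((m + x choose 2) + (m choose 2))"
        unfolding choose_two_add_choose_two[symmetric] by (rule power_int_of_nat)
      have nz: "qpoch t t n \<noteq> 0" for n using qpoch_pos[OF t, of n] by simp
      show ?thesis
        unfolding two_row_term_def e A_def sum_distrib_left y_def[symmetric] g_def[symmetric]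
      proof (intro sum.cong refl)
        \<comment> \<open>The denominator (t;t)_x cancels the numerator of the first binomial. The
          (t;t)_i left below, with (t;t)_{i+m} from \<open>Q\<close> and (t;t)_m, forms the binomial
          of m + i over i.\<close>
        fix i assume "i \<in> {0..x}"
        then have "qbinom t x (x - i) / qpoch t t x = 1 / (qpoch t t (x - i) * qpoch t t i)"
          using nz by (simp add: qbinom_def field_simps)
        moreover have "qpoch t t (i + m) / qpoch t t m = qbinom t (m + i) i * qpoch t t i"
          using nz by (simp add: qbinom_def add.commute)
        ultimately have "qbinom t x (x - i) / qpoch t t x * (qpoch t t (i + m) / qpoch t t m) =
            1 / qpoch t t (x - i) * qbinom t (m + i) i"
          using nz by simp
        then show "exp (- chi * t powi (L - int m)) *
            (t ^ ((m + x choose 2) + (m choose 2)) / (qpoch t t m * qpoch t t x)) *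
            ((-1) ^ m * (-1) ^ (x - i) * qbinom t x (x - i) * (qpoch t t (i + m) * g i)) =
          exp (- chi * t powi (L - int m)) * (-1) ^ m * t ^ ((m + x choose 2) + (m choose 2)) *
            ((-1) ^ (x - i) / qpoch t t (x - i) * qbinom t (m + i) i * g i)"
          using nz by (simp add: divide_simps) (simp add: mult_ac)
      qed
    qed
    finally show ?thesis .
  qed
  have "bij_betw (\<lambda>m. L - int m) UNIV {..L}"
    by (rule bij_betw_byWitness[where f' = "\<lambda>d. nat (L - d)"]) auto
  then have "infsum T {..L} = (\<Sum>\<^sub>\<infinity>m. complex_of_real (two_row_term t chi L x m))"
    using infsum_reindex_bij_betw[of "\<lambda>m. L - int m" UNIV "{..L}" T] by (simp add: T)
  \<comment> \<open>Absolute summability identifies the unordered sum with the ordinary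
    series.\<close>
  also have "\<dots> = complex_of_real (suminf (two_row_term t chi L x))"
  proof (intro infsumI norm_summable_imp_has_sum)
    show "summable (\<lambda>m. norm (complex_of_real (two_row_term t chi L x m)))"
      using summable_abs_two_row_term[OF assms] by simp
    show "(\<lambda>m. complex_of_real (two_row_term t chi L x m)) sums
        complex_of_real (suminf (two_row_term t chi L x))"
      by (intro sums_of_real summable_sums summable_rabs_cancel[OF summable_abs_two_row_term] assms)
  qed
  finally show ?thesis
    unfolding law_mass_def T_def by simp
qed

theorem corollary1p4:
  fixes t chi :: real and L :: int and x :: nat
    and M :: "'w measure" and \<L> :: "'w \<Rightarrow> int list"
  assumes "0 < t" and "t < 1" and "chi > 0"
    and "has_law_L 2 t chi M \<L>"
  shows "let f = (\<lambda>m::nat.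
           exp (- chi * t powi (L - int m)) * (-1) ^ m *
           t powi (int m ^ 2 + (int x - 1) * int m + int (x choose 2)) *
           (\<Sum>i=0..x. (-1) ^ (x - i) / qpoch t t (x - i) * qbinom t (m + i) i *
              ((t powi (L - int m) * chi) ^ (i + m) / fact (i + m) +
               (if i + m \<ge> 1
                then (t powi (L - int m) * chi) ^ (i + m - 1) / fact (i + m - 1) else 0))))
         in summable f \<and>
            measure M {\<omega>\<in>space M. \<L> \<omega> = [L + int x, L]} = 1 / qpoch_inf t t * suminf f"
proof -
  have "[L + int x, L] \<in> Sig 2" by (simp add: Sig_def)
  then have "complex_of_real (measure M {\<omega>\<in>space M. \<L> \<omega> = [L + int x, L]}) =
      law_mass 2 t chi [L + int x, L]"
    using assms(4) by (auto simp: has_law_L_def)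
  then have "measure M {\<omega>\<in>space M. \<L> \<omega> = [L + int x, L]} =
      1 / qpoch_inf t t * suminf (two_row_term t chi L x)"
    unfolding law_mass_two_row[OF assms(1-3)] of_real_eq_iff .
  moreover have "summable (two_row_term t chi L x)"
    using summable_abs_two_row_term[OF assms(1-3)] by (rule summable_rabs_cancel)
  ultimately show ?thesis
    unfolding Let_def two_row_term_def[abs_def] by (intro conjI)
qed

end
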